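(* The generalized roundness of $(\mathrm{Dgm}_\infty,w_\infty)$, the space of persistence diagrams with the bottleneck distance, is zero.
   Context: Let $\mathbb{R}^2_< = \{(x,y)\in\mathbb{R}^2 : x<y\}$ with metric $d_\infty(a,b)=\|a-b\|_\infty=\max(|a_x-b_x|,|a_y-b_y|)$, and let $\Delta$ be the diagonal in $\mathbb{R}^2$; for $a\in\mathbb{R}^2_<$, $d_\infty(a,\Delta)=\inf_{t\in\Delta}\|a-t\|_\infty=(a_y-a_x)/2$. A persistence diagram is a function $D:I\to\mathbb{R}^2_<$ with $I$ a countable (possibly finite or empty) set; $\emptyset$ denotes the diagram with empty index set. A partial matching between $D_1:I_1\to\mathbb{R}^2_<$ and $D_2:I_2\to\mathbb{R}^2_<$ is a triple $(I_1',I_2',f)$ with $I_1'\subseteq I_1$, $I_2'\subseteq I_2$ and $f:I_1'\to I_2'$ a bijection. Its $\infty$-cost is $$\mathrm{cost}_\infty(f)=\max\Big\{\sup_{i\in I_1'}d_\infty(D_1(i),D_2(f(i))),\ \sup_{i\in I_1\setminus I_1'}d_\infty(D_1(i),\Delta),\ \sup_{i\in I_2\setminus I_2'}d_\infty(D_2(i),\Delta)\Big\}\in[0,\infty]$$ (suprema over empty sets are $0$). Put $\tilde w_\infty(D_1,D_2)=\inf\{\mathrm{cost}_\infty(f)\}$ over all partial matchings between $D_1$ and $D_2$. The space $(\mathrm{Dgm}_\infty,w_\infty)$ is the set of persistence diagrams $D$ with $\tilde w_\infty(D,\emptyset)<\infty$, modulo the relation $D_1\sim D_2$ iff $\tilde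 w_\infty(D_1,D_2)=0$, with the induced metric $w_\infty$ (the bottleneck distance). Let $q\ge0$. A metric space $(X,d)$ has generalized roundness $q$ if for any $n\in\mathbb{N}$ and any $a_1,\dots,a_n,b_1,\dots,b_n\in X$ (not necessarily distinct), $$\sum_{1\le i<j\le n}\big(d(a_i,a_j)^q+d(b_i,b_j)^q\big)\le\sum_{1\le i,j\le n}d(a_i,b_j)^q.$$ The generalized roundness of $(X,d)$ is the supremum of the set of $q\in[0,\infty)$ such that $(X,d)$ has generalized roundness $q$. *)

theory Defs
  imports "HOL-Analysis.Analysis"
begin

section \<open>The plane above the diagonal\<close>

definition above_diag :: "(real \<times> real) set"
  where "above_diag = {(x, y). x < y}"

definition diagonal :: "(real \<times> real) set"
  where "diagonal = {(x, y). x = y}"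

definition d_infty :: "real \<times> real \<Rightarrow> real \<times> real \<Rightarrow> real"
  where "d_infty a b = infnorm (a - b)"

definition d_infty_diag :: "real \<times> real \<Rightarrow> real"
  where "d_infty_diag a = (INF t\<in>diagonal. d_infty a t)"

lemma d_infty_eq_max: "d_infty a b = max \<bar>fst a - fst b\<bar> \<bar>snd a - snd b\<bar>"
  by (cases a; cases b) (simp add: d_infty_def infnorm_Max Basis_prod_def max.commute)

lemma d_infty_nonneg [simp]: "0 \<le> d_infty a b"
  by (simp add: d_infty_def infnorm_pos_le)

lemma d_infty_self [simp]: "d_infty a a = 0"
  by (simp add: d_infty_eq_max)

lemma d_infty_commute: "d_infty a b = d_infty b a"
  by (simp add: d_infty_eq_max abs_minus_commute)

lemma d_infty_triangle: "d_infty a c \<le> d_infty a b + d_infty b c"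
  unfolding d_infty_eq_max by linarith

lemma d_infty_diag_eq:
  assumes "a \<in> above_diag"
  shows "d_infty_diag a = (snd a - fst a) / 2"
  unfolding d_infty_diag_def
proof (rule cInf_eq_minimum)
  have "d_infty a ((fst a + snd a) / 2, (fst a + snd a) / 2) = (snd a - fst a) / 2"
    using assms by (auto simp: above_diag_def d_infty_eq_max field_simps)
  moreover have "((fst a + snd a) / 2, (fst a + snd a) / 2) \<in> diagonal"
    by (simp add: diagonal_def)
  ultimately show "(snd a - fst a) / 2 \<in> d_infty a ` diagonal"
    by (metis image_eqI)
next
  fix r assume "r \<in> d_infty a ` diagonal"
  then obtain x y where "(x, y) \<in> diagonal" "r = d_infty a (x, y)" by auto
  then have "\<bar>fst a - x\<bar> \<le> r" "\<bar>snd a - x\<bar> \<le> r"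
    by (auto simp: diagonal_def d_infty_eq_max)
  then show "(snd a - fst a) / 2 \<le> r" by (simp add: abs_le_iff field_simps)
qed

section \<open>Persistence diagrams and partial matchings\<close>

text \<open>A diagram \<open>D : I \<rightarrow> \<real>\<^sup>2\<close> is a partial map whose domain is the index set \<open>I\<close>.\<close>

definition persistence_diagram :: "('i \<rightharpoonup> real \<times> real) \<Rightarrow> bool"
  where "persistence_diagram D \<longleftrightarrow> countable (dom D) \<and> ran D \<subseteq> above_diag"

definition partial_matching ::
    "('i \<rightharpoonup> real \<times> real) \<Rightarrow> ('j \<rightharpoonup> real \<times> real) \<Rightarrow> 'i set \<times> 'j set \<times> ('i \<Rightarrow> 'j) \<Rightarrow> bool"
  where "partial_matching D1 D2 = (\<lambda>(J1, J2, f).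
    J1 \<subseteq> dom D1 \<and> J2 \<subseteq> dom D2 \<and> bij_betw f J1 J2)"

text \<open>In \<open>ennreal\<close> the supremum of the empty set is \<open>0\<close>.\<close>

definition matching_cost ::
    "('i \<rightharpoonup> real \<times> real) \<Rightarrow> ('j \<rightharpoonup> real \<times> real) \<Rightarrow> 'i set \<times> 'j set \<times> ('i \<Rightarrow> 'j) \<Rightarrow> ennreal"
  where "matching_cost D1 D2 = (\<lambda>(J1, J2, f).
    Max {SUP i\<in>J1. ennreal (d_infty (the (D1 i)) (the (D2 (f i)))),
         SUP i\<in>dom D1 - J1. ennreal (d_infty_diag (the (D1 i))),
         SUP j\<in>dom D2 - J2. ennreal (d_infty_diag (the (D2 j)))})"

definition pre_bottleneck :: "('i \<rightharpoonup> real \<times> real) \<Rightarrow> ('j \<rightharpoonup> real \<times> real) \<Rightarrow> ennreal"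
  where "pre_bottleneck D1 D2 = (INF m\<in>{m. partial_matching D1 D2 m}. matching_cost D1 D2 m)"

section \<open>The space of persistence diagrams\<close>

text \<open>
  Index sets are taken inside \<open>nat\<close>, so that the diagrams form a set. By the lemma
  \<open>persistence_diagram_nat_reindex\<close> below this loses no point of the quotient.
\<close>

definition finite_cost_dgm :: "(nat \<rightharpoonup> real \<times> real) set"
  where "finite_cost_dgm = {D. persistence_diagram D \<and>
    pre_bottleneck D (Map.empty :: nat \<rightharpoonup> real \<times> real) < \<infinity>}"

definition dgm_rel :: "(nat \<rightharpoonup> real \<times> real) rel"
  where "dgm_rel = {(D1, D2). D1 \<in> finite_cost_dgm \<and> D2 \<in> finite_cost_dgm \<and> pre_bottleneck D1 D2 = 0}"

definition Dgm_infty :: "(nat \<rightharpoonup> real \<times> real) set set"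
  where "Dgm_infty = finite_cost_dgm // dgm_rel"

text \<open>Independence of the representatives is \<open>w_infty_class\<close> below.\<close>

definition w_infty :: "(nat \<rightharpoonup> real \<times> real) set \<Rightarrow> (nat \<rightharpoonup> real \<times> real) set \<Rightarrow> real"
  where "w_infty X Y = enn2real (pre_bottleneck (SOME D. D \<in> X) (SOME D. D \<in> Y))"

section \<open>Generalized roundness\<close>

text \<open>
  Since \<open>0 powr 0 = 0\<close>, the case \<open>q = 0\<close> uses the convention \<open>0\<^sup>0 = 0\<close>. The choice is
  immaterial: for \<open>q = 0\<close> the inequality holds in every metric space under either convention.
\<close>

definition has_generalized_roundness :: "'a set \<Rightarrow> ('a \<Rightarrow> 'a \<Rightarrow> real) \<Rightarrow> real \<Rightarrow> bool"
  where "has_generalized_roundness M d q \<longleftrightarrow>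
    (\<forall>n::nat. \<forall>a b. (\<forall>i\<in>{1..n}. a i \<in> M \<and> b i \<in> M) \<longrightarrow>
      (\<Sum>i=1..n. \<Sum>j=i+1..n. d (a i) (a j) powr q + d (b i) (b j) powr q)
      \<le> (\<Sum>i=1..n. \<Sum>j=1..n. d (a i) (b j) powr q))"

definition generalized_roundness :: "'a set \<Rightarrow> ('a \<Rightarrow> 'a \<Rightarrow> real) \<Rightarrow> ereal"
  where "generalized_roundness M d =
    Sup (ereal ` {q. 0 \<le> q \<and> has_generalized_roundness M d q})"

section \<open>The bottleneck distance is a metric\<close>

lemma d_infty_diag_nonneg: "0 \<le> d_infty_diag a"
  unfolding d_infty_diag_def by (rule cINF_greatest) (auto simp: diagonal_def)

lemma d_infty_diag_triangle: "d_infty_diag a \<le> d_infty a b + d_infty_diag b"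
proof -
  have "d_infty_diag a - d_infty a b \<le> d_infty b t" if "t \<in> diagonal" for t
  proof -
    have "d_infty_diag a \<le> d_infty a t"
      unfolding d_infty_diag_def
      by (rule cINF_lower) (use that in \<open>auto intro: bdd_belowI[of _ 0]\<close>)
    then show ?thesis
      using d_infty_triangle[of a t b] by linarith
  qed
  then have "d_infty_diag a - d_infty a b \<le> d_infty_diag b"
    unfolding d_infty_diag_def[of b] by (intro cINF_greatest) (auto simp: diagonal_def)
  then show ?thesis by linarith
qed

lemma matching_cost_le_iff:
  "matching_cost D1 D2 (J1, J2, f) \<le> c \<longleftrightarrow>
    (\<forall>i\<in>J1. ennreal (d_infty (the (D1 i)) (the (D2 (f i)))) \<le> c) \<and>
    (\<forall>i\<in>dom D1 - J1. ennreal (d_infty_diag (the (D1 i))) \<le> c) \<and>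
    (\<forall>j\<in>dom D2 - J2. ennreal (d_infty_diag (the (D2 j))) \<le> c)"
  by (simp add: matching_cost_def SUP_le_iff)

lemma pre_bottleneck_le:
  "partial_matching D1 D2 m \<Longrightarrow> matching_cost D1 D2 m \<le> c \<Longrightarrow> pre_bottleneck D1 D2 \<le> c"
  unfolding pre_bottleneck_def by (rule INF_lower2[of m]) auto

lemma pre_bottleneck_self [simp]: "pre_bottleneck D D = 0"
proof -
  have "matching_cost D D (dom D, dom D, id) \<le> 0"
    unfolding matching_cost_le_iff by simp
  then have "pre_bottleneck D D \<le> 0"
    by (intro pre_bottleneck_le[of _ _ "(dom D, dom D, id)"]) (auto simp: partial_matching_def)
  then show ?thesis by simp
qed

lemma pre_bottleneck_commute_le: "pre_bottleneck D1 D2 \<le> pre_bottleneck D2 D1"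
  unfolding pre_bottleneck_def[of D2]
proof (rule INF_greatest)
  fix m assume m: "m \<in> {m. partial_matching D2 D1 m}"
  obtain J K f where m_eq: "m = (J, K, f)" by (cases m)
  with m have J: "J \<subseteq> dom D2" "K \<subseteq> dom D1" "bij_betw f J K"
    by (auto simp: partial_matching_def)
  have c: "matching_cost D2 D1 (J, K, f) \<le> matching_cost D2 D1 m"
    by (simp add: m_eq)
  show "pre_bottleneck D1 D2 \<le> matching_cost D2 D1 m"
  proof (rule pre_bottleneck_le)
    show "partial_matching D1 D2 (K, J, inv_into J f)"
      using J by (auto simp: partial_matching_def intro: bij_betw_inv_into)
    have "ennreal (d_infty (the (D1 k)) (the (D2 (inv_into J f k)))) \<le> matching_cost D2 D1 m"
      if "k \<in> K" for k
    proof -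
      have "inv_into J f k \<in> J" "f (inv_into J f k) = k"
        using J(3) that by (auto simp: bij_betw_def inv_into_into f_inv_into_f)
      then show ?thesis
        using c unfolding matching_cost_le_iff by (metis d_infty_commute)
    qed
    then show "matching_cost D1 D2 (K, J, inv_into J f) \<le> matching_cost D2 D1 m"
      using c unfolding matching_cost_le_iff by blast
  qed
qed

lemma pre_bottleneck_commute: "pre_bottleneck D1 D2 = pre_bottleneck D2 D1"
  by (intro antisym pre_bottleneck_commute_le)

lemma ennreal_le_add:
  "r \<le> s + t \<Longrightarrow> 0 \<le> s \<Longrightarrow> 0 \<le> t \<Longrightarrow> ennreal s \<le> c \<Longrightarrow> ennreal t \<le> e \<Longrightarrow> ennreal r \<le> c + e"
  by (metis add_mono ennreal_leI ennreal_plus order_trans)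

lemma pre_bottleneck_triangle_cost:
  assumes "partial_matching D1 D2 m" "partial_matching D2 D3 m'"
  shows "pre_bottleneck D1 D3 \<le> matching_cost D1 D2 m + matching_cost D2 D3 m'"
proof -
  define c e where "c = matching_cost D1 D2 m" and "e = matching_cost D2 D3 m'"
  obtain A B f where m: "m = (A, B, f)" by (cases m)
  obtain B' C g where m': "m' = (B', C, g)" by (cases m')
  have AB: "A \<subseteq> dom D1" "B \<subseteq> dom D2" "f ` A = B" "inj_on f A"
    and BC: "B' \<subseteq> dom D2" "C \<subseteq> dom D3" "g ` B' = C" "inj_on g B'"
    using assms by (auto simp: m m' partial_matching_def bij_betw_def)
  have "matching_cost D1 D2 (A, B, f) \<le> c" "matching_cost D2 D3 (B', C, g) \<le> e"
    by (simp_all add: c_def e_def m m')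
  note le = this[unfolded matching_cost_le_iff]
  define A' where "A' = {i \<in> A. f i \<in> B'}"
  have "pre_bottleneck D1 D3 \<le> c + e"
  proof (rule pre_bottleneck_le)
    have "inj_on (g \<circ> f) A'"
      using AB(4) BC(4) by (auto simp: A'_def inj_on_def)
    then show "partial_matching D1 D3 (A', (g \<circ> f) ` A', g \<circ> f)"
      using AB BC by (auto simp: partial_matching_def bij_betw_def A'_def)
    show "matching_cost D1 D3 (A', (g \<circ> f) ` A', g \<circ> f) \<le> c + e"
      unfolding matching_cost_le_iff
    proof (intro conjI ballI)
      fix i assume "i \<in> A'"
      then have i: "i \<in> A" "f i \<in> B'" by (auto simp: A'_def)
      show "ennreal (d_infty (the (D1 i)) (the (D3 ((g \<circ> f) i)))) \<le> c + e"
        by (rule ennreal_le_add[OF d_infty_triangle[of _ _ "the (D2 (f i))"]])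
          (use le i in auto)
    next
      fix i assume i: "i \<in> dom D1 - A'"
      show "ennreal (d_infty_diag (the (D1 i))) \<le> c + e"
      proof (cases "i \<in> A")
        case True
        then have "f i \<in> dom D2 - B'" using i AB by (auto simp: A'_def)
        then show ?thesis
          by (intro ennreal_le_add[OF d_infty_diag_triangle[of _ "the (D2 (f i))"]])
            (use le True in \<open>auto simp: d_infty_diag_nonneg\<close>)
      next
        case False
        then have "ennreal (d_infty_diag (the (D1 i))) \<le> c" using le i by blast
        then show ?thesis by (simp add: add_increasing2)
      qed
    next
      fix k assume k: "k \<in> dom D3 - (g \<circ> f) ` A'"
      show "ennreal (d_infty_diag (the (D3 k))) \<le> c + e"
      proof (cases "k \<in> C")
        case True
        then obtain j where j: "j \<in> B'" "k = g j" using BC by blast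
        then have "j \<in> dom D2 - B" using k AB BC by (auto simp: A'_def)
        moreover have "d_infty_diag (the (D3 k))
            \<le> d_infty_diag (the (D2 j)) + d_infty (the (D2 j)) (the (D3 k))"
          using d_infty_diag_triangle[of "the (D3 k)" "the (D2 j)"]
          by (simp add: d_infty_commute)
        ultimately show ?thesis
          by (intro ennreal_le_add) (use le j in \<open>auto simp: d_infty_diag_nonneg\<close>)
      next
        case False
        then have "ennreal (d_infty_diag (the (D3 k))) \<le> e" using le k by blast
        then show ?thesis by (simp add: add_increasing)
      qed
    qed
  qed
  then show ?thesis by (simp add: c_def e_def)
qed

lemma pre_bottleneck_attained_below:
  assumes "pre_bottleneck D1 D2 < c"
  obtains m where "partial_matching D1 D2 m" "matching_cost D1 D2 m < c"
  using assms unfolding pre_bottleneck_def by (auto simp: INF_less_iff)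

lemma pre_bottleneck_triangle:
  "pre_bottleneck D1 D3 \<le> pre_bottleneck D1 D2 + pre_bottleneck D2 D3"
proof (rule ennreal_le_epsilon)
  fix \<epsilon> :: real
  assume fin: "pre_bottleneck D1 D2 + pre_bottleneck D2 D3 < top" and "0 < \<epsilon>"
  then have h: "0 < ennreal (\<epsilon> / 2)" by simp
  have "pre_bottleneck D1 D2 < pre_bottleneck D1 D2 + ennreal (\<epsilon> / 2)"
       "pre_bottleneck D2 D3 < pre_bottleneck D2 D3 + ennreal (\<epsilon> / 2)"
    using fin h by (auto simp: ennreal_add_left_cancel_less[of _ 0, simplified] less_top)
  then obtain m m' where m: "partial_matching D1 D2 m" "partial_matching D2 D3 m'"
    and le: "matching_cost D1 D2 m < pre_bottleneck D1 D2 + ennreal (\<epsilon> / 2)"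
      "matching_cost D2 D3 m' < pre_bottleneck D2 D3 + ennreal (\<epsilon> / 2)"
    by (meson pre_bottleneck_attained_below)
  have "pre_bottleneck D1 D3 \<le> matching_cost D1 D2 m + matching_cost D2 D3 m'"
    using m by (rule pre_bottleneck_triangle_cost)
  also have "\<dots> \<le> (pre_bottleneck D1 D2 + ennreal (\<epsilon> / 2)) + (pre_bottleneck D2 D3 + ennreal (\<epsilon> / 2))"
    using le by (intro add_mono) auto
  also have "\<dots> = pre_bottleneck D1 D2 + pre_bottleneck D2 D3 + (ennreal (\<epsilon> / 2) + ennreal (\<epsilon> / 2))"
    by (simp add: ac_simps)
  also have "ennreal (\<epsilon> / 2) + ennreal (\<epsilon> / 2) = ennreal \<epsilon>"
    using \<open>0 < \<epsilon>\<close> by (simp flip: ennreal_plus)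
  finally show "pre_bottleneck D1 D3 \<le> pre_bottleneck D1 D2 + pre_bottleneck D2 D3 + ennreal \<epsilon>" .
qed

lemma persistence_diagram_nat_reindex:
  assumes "persistence_diagram D"
  obtains D' :: "nat \<rightharpoonup> real \<times> real" where "persistence_diagram D'" "pre_bottleneck D D' = 0"
proof -
  define h where "h = to_nat_on (dom D)"
  have inj: "inj_on h (dom D)"
    using assms by (simp add: h_def persistence_diagram_def inj_on_to_nat_on)
  define D' where "D' n = (if n \<in> h ` dom D then D (inv_into (dom D) h n) else None)" for n
  have D'h: "D' (h i) = D i" if "i \<in> dom D" for i
    using that inj by (simp add: D'_def inv_into_f_f)
  have dom: "dom D' = h ` dom D"
  proof (rule set_eqI)
    fix n show "n \<in> dom D' \<longleftrightarrow> n \<in> h ` dom D"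
    proof (cases "n \<in> h ` dom D")
      case True
      then obtain i where "i \<in> dom D" "n = h i" by blast
      then show ?thesis using D'h[of i] by (simp add: domIff)
    next
      case False
      then show ?thesis by (simp add: domIff D'_def)
    qed
  qed
  have "ran D' \<subseteq> ran D"
    by (auto simp: D'_def ran_def split: if_splits)
  then have "persistence_diagram D'"
    using assms by (auto simp: persistence_diagram_def)
  moreover have "matching_cost D D' (dom D, dom D', h) \<le> 0"
    unfolding matching_cost_le_iff by (simp add: D'h)
  then have "pre_bottleneck D D' \<le> 0"
    by (intro pre_bottleneck_le[of _ _ "(dom D, dom D', h)"])
      (use inj in \<open>auto simp: partial_matching_def dom bij_betw_def\<close>)
  ultimately show ?thesis using that by simp
qed

lemma pre_bottleneck_finite:
  assumes "D1 \<in> finite_cost_dgm" "D2 \<in> finite_cost_dgm"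
  shows "pre_bottleneck D1 D2 < \<infinity>"
proof -
  have "pre_bottleneck D1 D2
      \<le> pre_bottleneck D1 (Map.empty :: nat \<rightharpoonup> real \<times> real) + pre_bottleneck (Map.empty :: nat \<rightharpoonup> real \<times> real) D2"
    by (rule pre_bottleneck_triangle)
  also have "\<dots> < \<infinity>"
    using assms by (simp add: finite_cost_dgm_def pre_bottleneck_commute[of Map.empty])
  finally show ?thesis .
qed

lemma equiv_dgm_rel: "equiv finite_cost_dgm dgm_rel"
proof (rule equivI)
  show "dgm_rel \<subseteq> finite_cost_dgm \<times> finite_cost_dgm" by (auto simp: dgm_rel_def)
  show "refl_on finite_cost_dgm dgm_rel" by (auto simp: dgm_rel_def refl_on_def)
  show "sym dgm_rel" by (rule symI) (metis (mono_tags, lifting) dgm_rel_def case_prodD case_prodI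
      mem_Collect_eq pre_bottleneck_commute)
  show "trans dgm_rel"
  proof (rule transI)
    fix x y z assume "(x, y) \<in> dgm_rel" "(y, z) \<in> dgm_rel"
    then show "(x, z) \<in> dgm_rel"
      using pre_bottleneck_triangle[of x z y] by (simp add: dgm_rel_def)
  qed
qed

lemma w_infty_class:
  assumes "X \<in> Dgm_infty" "Y \<in> Dgm_infty" "D \<in> X" "E \<in> Y"
  shows "ennreal (w_infty X Y) = pre_bottleneck D E"
proof -
  define D' E' where "D' = (SOME D. D \<in> X)" and "E' = (SOME D. D \<in> Y)"
  have "D' \<in> X" "E' \<in> Y"
    using someI[of "\<lambda>D. D \<in> X", OF assms(3)] someI[of "\<lambda>D. D \<in> Y", OF assms(4)]
    by (simp_all add: D'_def E'_def)
  with assms have "(D, D') \<in> dgm_rel" "(E, E') \<in> dgm_rel"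
    unfolding Dgm_infty_def by (metis equiv_dgm_rel quotient_eq_iff)+
  then have mem: "D' \<in> finite_cost_dgm" "E' \<in> finite_cost_dgm"
    and 0: "pre_bottleneck D D' = 0" "pre_bottleneck D' D = 0"
      "pre_bottleneck E E' = 0" "pre_bottleneck E' E = 0"
    using pre_bottleneck_commute[of D D'] pre_bottleneck_commute[of E E']
    by (simp_all add: dgm_rel_def)
  have "pre_bottleneck D E = pre_bottleneck D' E'"
  proof (rule antisym)
    show "pre_bottleneck D E \<le> pre_bottleneck D' E'"
      using pre_bottleneck_triangle[of D E D'] pre_bottleneck_triangle[of D' E E']
      by (simp add: 0)
    show "pre_bottleneck D' E' \<le> pre_bottleneck D E"
      using pre_bottleneck_triangle[of D' E' D] pre_bottleneck_triangle[of D E' E]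
      by (simp add: 0)
  qed
  then show ?thesis
    using pre_bottleneck_finite[OF mem] by (simp add: w_infty_def D'_def E'_def)
qed

lemma Metric_space_Dgm_infty: "Metric_space Dgm_infty w_infty"
proof
  have nonempty: "\<exists>D. D \<in> X" if "X \<in> Dgm_infty" for X
    using that in_quotient_imp_non_empty[OF equiv_dgm_rel] unfolding Dgm_infty_def by blast
  show nonneg: "0 \<le> w_infty X Y" for X Y
    by (simp add: w_infty_def)
  show "w_infty X Y = w_infty Y X" for X Y
    unfolding w_infty_def by (subst pre_bottleneck_commute) (rule refl)
  show "w_infty X Y = 0 \<longleftrightarrow> X = Y" if XY: "X \<in> Dgm_infty" "Y \<in> Dgm_infty" for X Y
  proof -
    obtain D E where DE: "D \<in> X" "E \<in> Y" using nonempty XY by meson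
    have mem: "D \<in> finite_cost_dgm" "E \<in> finite_cost_dgm"
      using XY DE in_quotient_imp_subset[OF equiv_dgm_rel] by (auto simp: Dgm_infty_def)
    have "w_infty X Y = 0 \<longleftrightarrow> pre_bottleneck D E = 0"
      using w_infty_class[OF XY DE] nonneg[of X Y] by (metis ennreal_eq_0_iff order_antisym order_refl)
    also have "\<dots> \<longleftrightarrow> (D, E) \<in> dgm_rel"
      using mem by (simp add: dgm_rel_def)
    also have "\<dots> \<longleftrightarrow> X = Y"
      using quotient_eq_iff[OF equiv_dgm_rel] XY DE by (metis Dgm_infty_def)
    finally show ?thesis .
  qed
  show "w_infty X Z \<le> w_infty X Y + w_infty Y Z"
    if XYZ: "X \<in> Dgm_infty" "Y \<in> Dgm_infty" "Z \<in> Dgm_infty" for X Y Z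
  proof -
    obtain D E F where DEF: "D \<in> X" "E \<in> Y" "F \<in> Z" using nonempty XYZ by meson
    have "ennreal (w_infty X Z) \<le> ennreal (w_infty X Y) + ennreal (w_infty Y Z)"
      using XYZ DEF by (simp add: w_infty_class pre_bottleneck_triangle)
    then show ?thesis
      using nonneg by (simp flip: ennreal_plus)
  qed
qed

end

(*
  The space of real sequences with values in [0,2] with the sup metric embeds isometrically into
  Dgm_infty: perturb one coordinate of a sequence of diagram points that are far apart from each
  other and from the diagonal. So Dgm_infty contains the vertices of the complete bipartite graphs
  K(n,n) with the path metric (Kuratowski embedding), and for these the roundness inequality
  reads n (n - 1) 2^q <= n^2, which fails for every q > 0 once n is large.
*)
theory Submission
  imports Defs
begin

text \<open>Trades the sums over \<open>i < j\<close> in the roundness inequality for sums over the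
  full square, which are easier to count. The zero diagonal makes the factor 2 exact.\<close>

lemma sum_offdiag_eq_double_triangle:
  fixes f :: "nat \<Rightarrow> nat \<Rightarrow> 'a::comm_semiring_1"
  assumes "\<And>i j. f i j = f j i" and "\<And>i. f i i = 0"
  shows "(\<Sum>i=1..n. \<Sum>j=1..n. f i j) = 2 * (\<Sum>i=1..n. \<Sum>j=i+1..n. f i j)"
proof (induction n)
  case (Suc n)
  have "(\<Sum>i=1..Suc n. \<Sum>j=i+1..Suc n. f i j)
      = (\<Sum>i=1..n. (\<Sum>j=i+1..n. f i j) + f i (Suc n))"
    by (auto intro!: sum.cong)
  moreover have "(\<Sum>j=1..n. f (Suc n) j) = (\<Sum>j=1..n. f j (Suc n))"
    by (rule sum.cong) (auto intro: assms(1))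
  ultimately show ?case
    using Suc.IH assms(2) by (simp add: sum.distrib mult_2 algebra_simps)
qed simp

text \<open>Grouping pairs by their common value \<open>s\<close> turns each double sum into a sum
  of products of the multiplicities \<open>N u s\<close>. The right side minus the left is then the
  sum of the squares \<open>(N a s - N b s)\<^sup>2\<close>.\<close>

lemma sum_of_bool_eq_le:
  fixes a b :: "'i \<Rightarrow> 'a"
  assumes "finite I"
  shows "2 * (\<Sum>i\<in>I. \<Sum>j\<in>I. of_bool (a i = b j) :: real)
    \<le> (\<Sum>i\<in>I. \<Sum>j\<in>I. of_bool (a i = a j)) + (\<Sum>i\<in>I. \<Sum>j\<in>I. of_bool (b i = b j))"
proof -
  define S where "S = a ` I \<union> b ` I"
  define N :: "('i \<Rightarrow> 'a) \<Rightarrow> 'a \<Rightarrow> real" where "N u s = (\<Sum>i\<in>I. of_bool (u i = s))" for u s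
  have fin: "finite S" using assms by (simp add: S_def)
  have count: "(\<Sum>i\<in>I. \<Sum>j\<in>I. of_bool (u i = v j)) = (\<Sum>s\<in>S. N u s * N v s)"
    if "u ` I \<subseteq> S" for u v
  proof -
    have "(\<Sum>s\<in>S. N u s * N v s)
        = (\<Sum>s\<in>S. \<Sum>i\<in>I. \<Sum>j\<in>I. of_bool (u i = s) * of_bool (v j = s))"
      by (simp add: N_def sum_product)
    also have "\<dots> = (\<Sum>i\<in>I. \<Sum>j\<in>I. \<Sum>s\<in>S. of_bool (u i = s) * of_bool (v j = s))"
      by (subst sum.swap, rule sum.cong[OF refl], rule sum.swap)
    also have "\<dots> = (\<Sum>i\<in>I. \<Sum>j\<in>I. of_bool (u i = v j))"
    proof (intro sum.cong refl)
      fix i j assume "i \<in> I"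
      then have "u i \<in> S" using that by blast
      have "(\<Sum>s\<in>S. of_bool (u i = s) * of_bool (v j = s))
          = (\<Sum>s\<in>S. if s = u i then of_bool (u i = v j) else (0::real))"
        by (rule sum.cong) auto
      also have "\<dots> = of_bool (u i = v j)"
        using fin \<open>u i \<in> S\<close> by simp
      finally show "(\<Sum>s\<in>S. of_bool (u i = s) * of_bool (v j = s)) = (of_bool (u i = v j) :: real)" .
    qed
    finally show ?thesis by simp
  qed
  have "0 \<le> (\<Sum>s\<in>S. (N a s - N b s)\<^sup>2)"
    by (simp add: sum_nonneg)
  also have "\<dots> = (\<Sum>s\<in>S. N a s * N a s) + (\<Sum>s\<in>S. N b s * N b s) - 2 * (\<Sum>s\<in>S. N a s * N b s)"
    by (simp add: power2_eq_square algebra_simps sum.distrib sum_subtractf sum_distrib_left)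
  finally show ?thesis
    using count[of a a] count[of a b] count[of b b] by (simp add: S_def)
qed

lemma (in Metric_space) has_generalized_roundness_0: "has_generalized_roundness M d 0"
  unfolding has_generalized_roundness_def
proof (intro allI impI)
  fix n :: nat and a b :: "nat \<Rightarrow> 'a"
  assume ab: "\<forall>i\<in>{1..n}. a i \<in> M \<and> b i \<in> M"
  \<comment> \<open>For exponent 0 only equality of points matters: as \<open>0 powr 0 = 0\<close>,
    the powers form the discrete metric \<open>e\<close>.\<close>
  define e :: "'a \<Rightarrow> 'a \<Rightarrow> real" where "e x y = 1 - of_bool (x = y)" for x y
  have powr0: "d x y powr 0 = e x y" if "x \<in> M" "y \<in> M" for x y
    using that by (simp add: e_def)
  have triangle: "(\<Sum>i=1..n. \<Sum>j=1..n. e (u i) (u j)) = 2 * (\<Sum>i=1..n. \<Sum>j=i+1..n. e (u i) (u j))" for u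
    by (rule sum_offdiag_eq_double_triangle) (auto simp: e_def)
  have full: "(\<Sum>i=1..n. \<Sum>j=1..n. e (u i) (v j))
      = real n * real n - (\<Sum>i=1..n. \<Sum>j=1..n. of_bool (u i = v j))" for u v
    by (simp add: e_def sum_subtractf)
  have "(\<Sum>i=1..n. \<Sum>j=i+1..n. d (a i) (a j) powr 0 + d (b i) (b j) powr 0)
      = (\<Sum>i=1..n. \<Sum>j=i+1..n. e (a i) (a j) + e (b i) (b j))"
    using ab by (intro sum.cong refl arg_cong2[where f = "(+)"] powr0) auto
  also have "\<dots> = (\<Sum>i=1..n. \<Sum>j=i+1..n. e (a i) (a j)) + (\<Sum>i=1..n. \<Sum>j=i+1..n. e (b i) (b j))"
    by (simp add: sum.distrib)
  \<comment> \<open>After doubling, both sides are \<open>2 * n * n\<close> minus coincidence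
    counts, so the claim becomes \<open>sum_of_bool_eq_le\<close>.\<close>
  also have "\<dots> \<le> (\<Sum>i=1..n. \<Sum>j=1..n. e (a i) (b j))"
    using sum_of_bool_eq_le[OF finite_atLeastAtMost, of a b 1 n] triangle[of a] triangle[of b]
      full[of a a] full[of b b] full[of a b] by linarith
  also have "\<dots> = (\<Sum>i=1..n. \<Sum>j=1..n. d (a i) (b j) powr 0)"
    using ab by (intro sum.cong refl powr0[symmetric]) auto
  finally show "(\<Sum>i=1..n. \<Sum>j=i+1..n. d (a i) (a j) powr 0 + d (b i) (b j) powr 0)
      \<le> (\<Sum>i=1..n. \<Sum>j=1..n. d (a i) (b j) powr 0)" .
qed

lemma not_has_generalized_roundness_bipartite:
  fixes a b :: "nat \<Rightarrow> 'a"
  assumes M: "range a \<subseteq> M" "range b \<subseteq> M"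
    and aa: "\<And>i j. i \<noteq> j \<Longrightarrow> d (a i) (a j) = 2"
    and bb: "\<And>i j. i \<noteq> j \<Longrightarrow> d (b i) (b j) = 2"
    and ab: "\<And>i j. d (a i) (b j) = 1"
    and q: "0 < q"
  shows "\<not> has_generalized_roundness M d q"
proof
  assume "has_generalized_roundness M d q"
  then have le: "(\<Sum>i=1..n. \<Sum>j=i+1..n. d (a i) (a j) powr q + d (b i) (b j) powr q)
      \<le> (\<Sum>i=1..n. \<Sum>j=1..n. d (a i) (b j) powr q)" for n
    using M unfolding has_generalized_roundness_def by blast
  define c where "c = 2 powr q"
  have c: "1 < c" using q by (simp add: c_def)
  define f where "f i j = (if i = j then 0 else c)" for i j :: nat
  have "real n * (real n - 1) * c \<le> real n * real n" for n
  proof -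
    have "(\<Sum>j=1..n. f i j) = (real n - 1) * c" if "i \<in> {1..n}" for i
    proof -
      have "(\<Sum>j=1..n. f i j) = (\<Sum>j=1..n. c - (if j = i then c else 0))"
        by (rule sum.cong) (auto simp: f_def)
      also have "\<dots> = (real n - 1) * c"
        using that by (simp add: sum_subtractf algebra_simps)
      finally show ?thesis .
    qed
    then have "real n * (real n - 1) * c = (\<Sum>i=1..n. \<Sum>j=1..n. f i j)"
      by simp
    \<comment> \<open>The factor 2 is absorbed because each pair \<open>i < j\<close> contributes
      \<open>c\<close> once from \<open>a\<close> and once from \<open>b\<close>.\<close>
    also have "\<dots> = 2 * (\<Sum>i=1..n. \<Sum>j=i+1..n. f i j)"
      by (rule sum_offdiag_eq_double_triangle) (auto simp: f_def)
    also have "\<dots> = (\<Sum>i=1..n. \<Sum>j=i+1..n. d (a i) (a j) powr q + d (b i) (b j) powr q)"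
      unfolding sum_distrib_left by (intro sum.cong refl) (simp add: f_def aa bb c_def)
    also have "\<dots> \<le> (\<Sum>i=1..n. \<Sum>j=1..n. d (a i) (b j) powr q)"
      by (rule le)
    also have "\<dots> = real n * real n" by (simp add: ab)
    finally show ?thesis .
  qed
  \<comment> \<open>Cancelling one factor \<open>n\<close> leaves
    \<open>(n - 1) * c \<le> n\<close>. Since \<open>c > 1\<close>, this forces
    \<open>n \<le> c / (c - 1)\<close>.\<close>
  moreover obtain n where n: "c / (c - 1) < real n"
    using reals_Archimedean2 by blast
  moreover have "0 < real n"
    using n c by (smt (verit) divide_pos_pos)
  ultimately have "(real n - 1) * c \<le> real n"
    by (metis mult.assoc mult_le_cancel_left_pos)
  then show False
    using n c by (simp add: field_simps)
qed

text \<open>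
  The points are 10 apart and at distance at least 2 from the diagonal, so among sequences with
  values in \<open>{0..2}\<close> no matching beats the identity.
\<close>

definition seq_dgm :: "(nat \<Rightarrow> real) \<Rightarrow> nat \<rightharpoonup> real \<times> real"
  where "seq_dgm x k = Some (10 * real k, 10 * real k + 4 + x k)"

lemma dom_seq_dgm [simp]: "dom (seq_dgm x) = UNIV"
  by (auto simp: seq_dgm_def)

lemma seq_dgm_diag:
  assumes "range x \<subseteq> {0..2}"
  shows "d_infty_diag (the (seq_dgm x k)) = 2 + x k / 2"
proof -
  have "0 \<le> x k" using assms by (auto simp: image_subset_iff)
  then show ?thesis
    by (subst d_infty_diag_eq) (auto simp: seq_dgm_def above_diag_def field_simps)
qed

lemma seq_dgm_in_finite_cost_dgm:
  assumes x: "range x \<subseteq> {0..2}"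
  shows "seq_dgm x \<in> finite_cost_dgm"
proof -
  have bounds: "0 \<le> x k" "x k \<le> 2" for k using x by (auto simp: image_subset_iff)
  have diag: "d_infty_diag (the (seq_dgm x k)) \<le> 3" for k
    using bounds(2)[of k] by (simp add: seq_dgm_diag[OF x])
  have "0 < 4 + x k" for k using bounds(1)[of k] by simp
  then have "ran (seq_dgm x) \<subseteq> above_diag"
    by (auto simp: ran_def seq_dgm_def above_diag_def add.assoc)
  \<comment> \<open>The empty matching leaves every point to the diagonal, at cost at most 2 + 2/2 =
    3. Deleting \<open>ennreal_numeral\<close> keeps \<open>ennreal 3\<close> in the form that
    \<open>ennreal_leI\<close> needs.\<close>
  moreover have "pre_bottleneck (seq_dgm x) (Map.empty :: nat \<rightharpoonup> real \<times> real) \<le> ennreal 3"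
    by (rule pre_bottleneck_le[of _ _ "({}, {}, id)"])
      (auto simp: partial_matching_def matching_cost_le_iff intro!: ennreal_leI diag simp del: ennreal_numeral)
  ultimately show ?thesis
    by (auto simp: finite_cost_dgm_def persistence_diagram_def intro: le_less_trans)
qed

text \<open>The identity matching realizes the supremum. Conversely, the lower bound holds for each
  \<open>k\<close> separately, according to whether a matching fixes \<open>k\<close>, sends it
  elsewhere or leaves it unmatched.\<close>

lemma pre_bottleneck_seq_dgm:
  assumes x: "range x \<subseteq> {0..2}" and y: "range y \<subseteq> {0..2}"
  shows "pre_bottleneck (seq_dgm x) (seq_dgm y) = (SUP k. ennreal \<bar>x k - y k\<bar>)"
proof (rule antisym)
  show "pre_bottleneck (seq_dgm x) (seq_dgm y) \<le> (SUP k. ennreal \<bar>x k - y k\<bar>)"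
    by (rule pre_bottleneck_le[of _ _ "(UNIV, UNIV, id)"])
      (auto simp: partial_matching_def matching_cost_le_iff seq_dgm_def d_infty_eq_max intro: SUP_upper)
  show "(SUP k. ennreal \<bar>x k - y k\<bar>) \<le> pre_bottleneck (seq_dgm x) (seq_dgm y)"
    unfolding pre_bottleneck_def
  proof (intro SUP_least INF_greatest)
    fix k and m :: "nat set \<times> nat set \<times> (nat \<Rightarrow> nat)"
    obtain J K f where m: "m = (J, K, f)" by (cases m)
    have "0 \<le> x k" "x k \<le> 2" "0 \<le> y k" "y k \<le> 2" using x y by (auto simp: image_subset_iff)
    then have xy: "\<bar>x k - y k\<bar> \<le> 2" by linarith
    define c where "c = matching_cost (seq_dgm x) (seq_dgm y) m"
    have "matching_cost (seq_dgm x) (seq_dgm y) (J, K, f) \<le> c"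
      by (simp add: c_def m)
    note cost = this[unfolded matching_cost_le_iff]
    show "ennreal \<bar>x k - y k\<bar> \<le> matching_cost (seq_dgm x) (seq_dgm y) m"
    proof (cases "k \<in> J")
      case True
      have "\<bar>x k - y k\<bar> \<le> d_infty (the (seq_dgm x k)) (the (seq_dgm y (f k)))"
      proof (cases "f k = k")
        case True
        then show ?thesis by (simp add: seq_dgm_def d_infty_eq_max)
      next
        case False
        \<comment> \<open>Distinct indices put the first coordinates at least 10 apart, more than
          the bound 2 on the difference of \<open>x k\<close> and \<open>y k\<close>.\<close>
        then have "1 \<le> \<bar>real k - real (f k)\<bar>" by linarith
        then show ?thesis using xy by (simp add: seq_dgm_def d_infty_eq_max)
      qed
      then show ?thesis
        using cost True unfolding c_def by (blast intro: order_trans ennreal_leI)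
    next
      case False
      \<comment> \<open>The distance to the diagonal is \<open>2 + x k / 2\<close>, hence at least
        2.\<close>
      have "\<bar>x k - y k\<bar> \<le> d_infty_diag (the (seq_dgm x k))"
        using xy \<open>0 \<le> x k\<close> by (simp add: seq_dgm_diag[OF x])
      then show ?thesis
        using cost False unfolding c_def dom_seq_dgm by (blast intro: order_trans ennreal_leI)
    qed
  qed
qed

definition seq_class :: "(nat \<Rightarrow> real) \<Rightarrow> (nat \<rightharpoonup> real \<times> real) set"
  where "seq_class x = dgm_rel `` {seq_dgm x}"

lemma seq_class_in_Dgm_infty: "range x \<subseteq> {0..2} \<Longrightarrow> seq_class x \<in> Dgm_infty"
  unfolding seq_class_def Dgm_infty_def by (intro quotientI seq_dgm_in_finite_cost_dgm)

text \<open>The supremum is replaced by a bound and an index \<open>k\<close> attaining it, so each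
  distance below needs only one witness coordinate. The equation at \<open>k\<close> also supplies
  \<open>0 \<le> r\<close>, needed to leave \<open>ennreal\<close>.\<close>

lemma w_infty_seq_class:
  assumes x: "range x \<subseteq> {0..2}" and y: "range y \<subseteq> {0..2}"
    and le: "\<And>k. \<bar>x k - y k\<bar> \<le> r" and eq: "\<bar>x k - y k\<bar> = r"
  shows "w_infty (seq_class x) (seq_class y) = r"
proof -
  have "ennreal (w_infty (seq_class x) (seq_class y)) = pre_bottleneck (seq_dgm x) (seq_dgm y)"
    using equiv_class_self[OF equiv_dgm_rel] x y
    by (intro w_infty_class seq_class_in_Dgm_infty)
      (auto simp: seq_class_def seq_dgm_in_finite_cost_dgm)
  also have "\<dots> = ennreal r"
    unfolding pre_bottleneck_seq_dgm[OF x y]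
    by (rule antisym) (auto intro!: SUP_least SUP_upper2[of k] ennreal_leI simp: le eq)
  finally show ?thesis
    using eq by (subst (asm) ennreal_inj) (auto simp: w_infty_def)
qed

text \<open>
  Kuratowski coordinates of the two vertex classes of an infinite complete bipartite graph: entry
  \<open>2 * k\<close> is the distance to the \<open>k\<close>-th left vertex, entry \<open>2 * k + 1\<close> to the \<open>k\<close>-th right one.
\<close>

definition left_vertex :: "nat \<Rightarrow> nat \<Rightarrow> real"
  where "left_vertex i k = (if odd k then 1 else if k = 2 * i then 0 else 2)"

definition right_vertex :: "nat \<Rightarrow> nat \<Rightarrow> real"
  where "right_vertex i k = (if even k then 1 else if k = 2 * i + 1 then 0 else 2)"

lemma range_vertex:
  "range (left_vertex i) \<subseteq> {0..2}" "range (right_vertex i) \<subseteq> {0..2}"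
  by (auto simp: left_vertex_def right_vertex_def)

lemma Dgm_infty_not_has_generalized_roundness:
  assumes "0 < q"
  shows "\<not> has_generalized_roundness Dgm_infty w_infty q"
proof (rule not_has_generalized_roundness_bipartite[OF _ _ _ _ _ assms])
  show "range (\<lambda>i. seq_class (left_vertex i)) \<subseteq> Dgm_infty"
    "range (\<lambda>i. seq_class (right_vertex i)) \<subseteq> Dgm_infty"
    using seq_class_in_Dgm_infty range_vertex by auto
  \<comment> \<open>Odd entries agree and even ones lie in {0, 2}; at \<open>2 * i\<close> they are
    0 and 2 because \<open>i \<noteq> j\<close>.\<close>
  show "w_infty (seq_class (left_vertex i)) (seq_class (left_vertex j)) = 2" if "i \<noteq> j" for i j
    by (rule w_infty_seq_class[OF range_vertex(1) range_vertex(1), of _ _ _ "2 * i"])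
      (use that in \<open>auto simp: left_vertex_def\<close>)
  show "w_infty (seq_class (right_vertex i)) (seq_class (right_vertex j)) = 2" if "i \<noteq> j" for i j
    by (rule w_infty_seq_class[OF range_vertex(2) range_vertex(2), of _ _ _ "2 * i + 1"])
      (use that in \<open>auto simp: right_vertex_def\<close>)
  \<comment> \<open>In every coordinate one entry is 1 and the other is 0 or 2, so the difference is
    constantly 1.\<close>
  show "w_infty (seq_class (left_vertex i)) (seq_class (right_vertex j)) = 1" for i j
    by (rule w_infty_seq_class[OF range_vertex, of _ _ _ "2 * i"])
      (auto simp: left_vertex_def right_vertex_def)
qed

theorem corollary20:
  shows "generalized_roundness Dgm_infty w_infty = 0"
proof -
  \<comment> \<open>Membership of 0 matters: in \<open>ereal\<close> the supremum of the empty set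
    is \<open>-\<infinity>\<close>.\<close>
  have "{q. 0 \<le> q \<and> has_generalized_roundness Dgm_infty w_infty q} = {0}"
    using Metric_space.has_generalized_roundness_0[OF Metric_space_Dgm_infty]
      Dgm_infty_not_has_generalized_roundness by (auto simp: order_le_less)
  then show ?thesis
    by (simp add: generalized_roundness_def zero_ereal_def)
qed

end
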